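(* Let $ABC$ be a triangle with medial triangle $M_1M_2M_3$, and let $\mathcal{K}$ be the Darboux cubic of the triangle $M_1M_2M_3$. Then $\mathcal{K}$ passes through the Spieker point of $ABC$, the center of the Euler circle (nine-point center) of $ABC$, the circumcenter of $ABC$, the orthocenter of $ABC$, the complementary conjugate of the orthocenter of $ABC$, the midpoints $M_1,M_2,M_3$ of the sides of $ABC$, and the antipodes of the vertices of the medial triangle on the circumcircle of the medial triangle.
   Context: The medial triangle of $ABC$ is the triangle whose vertices are the midpoints of the sides of $ABC$. The Darboux cubic of a triangle is the cubic curve passing through its vertices, its excenters, its incenter, its circumcenter and its Bevan point (it is the locus of points $P$ such that $P$, its isogonal conjugate, and the de Longchamps point are collinear). The Bevan point of a triangle is the circumcenter of its excentral triangle (the triangle of its excenters); the de Longchamps point is the reflection of the orthocenter in the circumcenter. The Spieker point of $ABC$ is the incenter of its medial triangle. The complementary conjugate of a point $P$ with respect to $ABC$ is the isogonal conjugate of $P$ with respect to the medial triangle of $ABC$. *)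

theory Defs
  imports "HOL-Analysis.Analysis"
begin

text \<open>
  A point of the real projective plane is given by nonzero homogeneous coordinates
  \<open>(X, t)\<close> with \<open>X :: real^2\<close>: for \<open>t \<noteq> 0\<close> this is the affine point \<open>X /\<^sub>R t\<close>, and \<open>(d, 0)\<close>
  is the point at infinity in direction \<open>d\<close>. Points at infinity are needed because an
  isogonal conjugate may be one (exactly for the points of the circumcircle that are not
  vertices); in particular, the complementary conjugate of the orthocenter of a right
  triangle is at infinity.
\<close>

type_synonym hpoint = "(real^2) \<times> real"

definition hpt :: "real^2 \<Rightarrow> hpoint" where
  "hpt X = (X, 1)"

text \<open>The projective line with coefficients \<open>l \<noteq> 0\<close> is \<open>{P. l \<bullet> P = 0}\<close>.\<close>

definition hcollinear :: "hpoint \<Rightarrow> hpoint \<Rightarrow> hpoint \<Rightarrow> bool" where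
  "hcollinear P Q R \<longleftrightarrow> (\<exists>l. l \<noteq> 0 \<and> l \<bullet> P = 0 \<and> l \<bullet> Q = 0 \<and> l \<bullet> R = 0)"

definition cubic_form :: "(nat \<Rightarrow> nat \<Rightarrow> real) \<Rightarrow> hpoint \<Rightarrow> real" where
  "cubic_form c P =
     (\<Sum>i\<le>3. \<Sum>j\<le>3 - i. c i j * (fst P $ 1) ^ i * (fst P $ 2) ^ j * snd P ^ (3 - i - j))"

definition cubic_curve :: "hpoint set \<Rightarrow> bool" where
  "cubic_curve K \<longleftrightarrow>
     (\<exists>c. (\<exists>i j. i + j \<le> 3 \<and> c i j \<noteq> 0) \<and> K = {P. P \<noteq> 0 \<and> cubic_form c P = 0})"

definition circumcenter :: "real^2 \<Rightarrow> real^2 \<Rightarrow> real^2 \<Rightarrow> real^2" where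
  "circumcenter A B C = (THE P. dist P A = dist P B \<and> dist P B = dist P C)"

definition orthocenter :: "real^2 \<Rightarrow> real^2 \<Rightarrow> real^2 \<Rightarrow> real^2" where
  "orthocenter A B C =
     (THE H. (H - A) \<bullet> (B - C) = 0 \<and> (H - B) \<bullet> (C - A) = 0 \<and> (H - C) \<bullet> (A - B) = 0)"

text \<open>Direction of the internal bisector of the angle at \<open>A\<close>; the external bisector at
  \<open>A\<close> is the perpendicular to it through \<open>A\<close>. Note that \<open>sgn v = v /\<^sub>R norm v\<close>.\<close>

definition bisector_dir :: "real^2 \<Rightarrow> real^2 \<Rightarrow> real^2 \<Rightarrow> real^2" where
  "bisector_dir A B C = sgn (B - A) + sgn (C - A)"

definition incenter :: "real^2 \<Rightarrow> real^2 \<Rightarrow> real^2 \<Rightarrow> real^2" where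
  "incenter A B C =
     (THE P. collinear {0, bisector_dir A B C, P - A} \<and>
             collinear {0, bisector_dir B C A, P - B} \<and>
             collinear {0, bisector_dir C A B, P - C})"

text \<open>The excenter opposite \<open>A\<close>: the internal bisector at \<open>A\<close> meets the external ones
  at \<open>B\<close> and \<open>C\<close>.\<close>

definition excenter :: "real^2 \<Rightarrow> real^2 \<Rightarrow> real^2 \<Rightarrow> real^2" where
  "excenter A B C =
     (THE P. collinear {0, bisector_dir A B C, P - A} \<and>
             bisector_dir B C A \<bullet> (P - B) = 0 \<and>
             bisector_dir C A B \<bullet> (P - C) = 0)"

definition bevan_point :: "real^2 \<Rightarrow> real^2 \<Rightarrow> real^2 \<Rightarrow> real^2" where
  "bevan_point A B C = circumcenter (excenter A B C) (excenter B C A) (excenter C A B)"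

definition de_longchamps_point :: "real^2 \<Rightarrow> real^2 \<Rightarrow> real^2 \<Rightarrow> real^2" where
  "de_longchamps_point A B C = 2 *\<^sub>R circumcenter A B C - orthocenter A B C"

definition spieker_point :: "real^2 \<Rightarrow> real^2 \<Rightarrow> real^2 \<Rightarrow> real^2" where
  "spieker_point A B C = incenter (midpoint B C) (midpoint C A) (midpoint A B)"

definition euler_circle_center :: "real^2 \<Rightarrow> real^2 \<Rightarrow> real^2 \<Rightarrow> real^2" where
  "euler_circle_center A B C = circumcenter (midpoint B C) (midpoint C A) (midpoint A B)"

text \<open>The antipode of \<open>A\<close> on the circumcircle of \<open>ABC\<close>.\<close>

definition antipode :: "real^2 \<Rightarrow> real^2 \<Rightarrow> real^2 \<Rightarrow> real^2" where
  "antipode A B C = 2 *\<^sub>R circumcenter A B C - A"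

text \<open>Direction of the line joining the affine point \<open>A\<close> to the projective point \<open>P\<close>;
  it is zero iff \<open>P\<close> is \<open>A\<close>.\<close>

definition dir_from :: "real^2 \<Rightarrow> hpoint \<Rightarrow> real^2" where
  "dir_from A P = fst P - snd P *\<^sub>R A"

text \<open>Reflection in the line spanned by \<open>w \<noteq> 0\<close>.\<close>

definition reflect_in :: "real^2 \<Rightarrow> real^2 \<Rightarrow> real^2" where
  "reflect_in w u = (2 * (u \<bullet> w) / (w \<bullet> w)) *\<^sub>R w - u"

text \<open>The lines \<open>AP\<close> and \<open>AQ\<close> are symmetric about the bisector of the angle at \<open>A\<close>. No
  condition is imposed if \<open>P\<close> or \<open>Q\<close> is \<open>A\<close>.\<close>

definition isogonal_at :: "real^2 \<Rightarrow> real^2 \<Rightarrow> real^2 \<Rightarrow> hpoint \<Rightarrow> hpoint \<Rightarrow> bool" where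
  "isogonal_at A B C P Q \<longleftrightarrow>
     collinear {0, reflect_in (bisector_dir A B C) (dir_from A P), dir_from A Q}"

text \<open>
  Isogonal conjugacy. A point \<open>P\<close> that is not a vertex has exactly one conjugate \<open>Q\<close>
  (up to scaling of the coordinates), which is the opposite vertex if \<open>P\<close> is on a
  sideline. The conjugates of a vertex are all the points of the opposite sideline, as in
  the usual extension of the isogonal transformation to its singular points.
\<close>

definition isogonal :: "real^2 \<Rightarrow> real^2 \<Rightarrow> real^2 \<Rightarrow> hpoint \<Rightarrow> hpoint \<Rightarrow> bool" where
  "isogonal A B C P Q \<longleftrightarrow> P \<noteq> 0 \<and> Q \<noteq> 0 \<and>
     isogonal_at A B C P Q \<and> isogonal_at B C A P Q \<and> isogonal_at C A B P Q"

text \<open>For \<open>P\<close> not a vertex, the choice only concerns the scaling of the coordinates.\<close>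

definition isogonal_conjugate :: "real^2 \<Rightarrow> real^2 \<Rightarrow> real^2 \<Rightarrow> hpoint \<Rightarrow> hpoint" where
  "isogonal_conjugate A B C P = (SOME Q. isogonal A B C P Q)"

definition complementary_conjugate :: "real^2 \<Rightarrow> real^2 \<Rightarrow> real^2 \<Rightarrow> hpoint \<Rightarrow> hpoint" where
  "complementary_conjugate A B C P =
     isogonal_conjugate (midpoint B C) (midpoint C A) (midpoint A B) P"

text \<open>
  The nine points alone determine the cubic only if the triangle is scalene: for an
  isosceles triangle the axis is a component, and the remaining conic is only known to
  pass through four points. The locus property singles out the Darboux cubic in all
  cases. A vertex always satisfies it, since the line joining it to the de Longchamps
  point meets the opposite sideline, possibly at infinity.
\<close>

definition is_darboux_cubic :: "real^2 \<Rightarrow> real^2 \<Rightarrow> real^2 \<Rightarrow> hpoint set \<Rightarrow> bool" where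
  "is_darboux_cubic A B C K \<longleftrightarrow>
     cubic_curve K \<and>
     hpt ` {A, B, C, excenter A B C, excenter B C A, excenter C A B,
            incenter A B C, circumcenter A B C, bevan_point A B C} \<subseteq> K \<and>
     K = {P. \<exists>Q. isogonal A B C P Q \<and> hcollinear P Q (hpt (de_longchamps_point A B C))}"

definition darboux_cubic :: "real^2 \<Rightarrow> real^2 \<Rightarrow> real^2 \<Rightarrow> hpoint set" where
  "darboux_cubic A B C = (THE K. is_darboux_cubic A B C K)"

end

theory Submission
  imports Defs
begin

text \<open>
  With complex coordinates centered at the circumcenter and vertices \<open>a, b, c\<close>, the isogonality
  conditions at the three vertices are equivalent to one equation
  \<open>g p\<^sup>* q\<^sup>* + R\<^sup>4 (p + q - h) = 0\<close>, where \<open>g = a b c\<close>, \<open>h = a + b + c\<close> and \<open>p\<^sup>*\<close> is the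
  conjugate of \<open>p\<close>. Its real and imaginary parts, together with collinearity with the de
  Longchamps point, are three linear conditions on the homogeneous coordinates of \<open>Q\<close>, whose
  determinant is a cubic form in \<open>P\<close>: this is the Darboux cubic. The form is odd, so the cubic is
  symmetric about the circumcenter. The incenter and excenters are their own conjugates, the
  circumcenter and orthocenter are conjugate, and the Bevan point, the antipodes of the vertices
  and the de Longchamps point are the reflections of the incenter, the vertices and the
  orthocenter in the circumcenter. For the medial triangle, the orthocenter and the de Longchamps
  point are the circumcenter and the orthocenter of \<open>ABC\<close>.
\<close>

section \<open>Planar coordinates and bisectors\<close>

definition cross2 :: "real^2 \<Rightarrow> real^2 \<Rightarrow> real" where
  "cross2 u v = u$1 * v$2 - u$2 * v$1"

definition cx :: "real^2 \<Rightarrow> complex" where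
  "cx u = Complex (u$1) (u$2)"

definition det3 :: "hpoint \<Rightarrow> hpoint \<Rightarrow> hpoint \<Rightarrow> real" where
  "det3 P Q R =
     fst P $ 1 * (fst Q $ 2 * snd R - snd Q * fst R $ 2)
   - fst P $ 2 * (fst Q $ 1 * snd R - snd Q * fst R $ 1)
   + snd P * (fst Q $ 1 * fst R $ 2 - fst Q $ 2 * fst R $ 1)"

lemma inner_vec2: "(u::real^2) \<bullet> v = u$1 * v$1 + u$2 * v$2"
  by (simp add: inner_vec_def sum_2)

lemma vec2_eq_iff: "(u::real^2) = v \<longleftrightarrow> u$1 = v$1 \<and> u$2 = v$2"
  by (simp add: vec_eq_iff forall_2)

text \<open>Lagrange's identity turns the equality case of Cauchy-Schwarz into the vanishing of
  \<open>cross2 u v\<close>.\<close>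

lemma collinear_0_iff_cross2: "collinear {0, u, v} \<longleftrightarrow> cross2 u v = 0"
proof -
  have "(u \<bullet> u) * (v \<bullet> v) - (u \<bullet> v)\<^sup>2 = (cross2 u v)\<^sup>2"
    by (simp add: inner_vec2 cross2_def power2_eq_square algebra_simps)
  moreover have "\<bar>u \<bullet> v\<bar> = norm u * norm v \<longleftrightarrow> (u \<bullet> v)\<^sup>2 = (u \<bullet> u) * (v \<bullet> v)"
    by (subst power2_eq_iff_nonneg[symmetric])
       (simp_all add: power_mult_distrib power2_norm_eq_inner)
  moreover have "(cross2 u v)\<^sup>2 = 0 \<longleftrightarrow> cross2 u v = 0" by simp
  ultimately show ?thesis unfolding norm_cauchy_schwarz_equal[symmetric] by linarith
qed

lemma collinear_iff_cross2: "collinear {A, B, C} \<longleftrightarrow> cross2 (B - A) (C - A) = 0"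
proof -
  have "collinear {A, B, C} \<longleftrightarrow> collinear {B, A, C}" by (simp add: insert_commute)
  also have "\<dots> \<longleftrightarrow> cross2 (B - A) (C - A) = 0"
    by (subst collinear_3) (simp_all only: NO_MATCH_def collinear_0_iff_cross2)
  finally show ?thesis .
qed

lemma hinner: "(P::hpoint) \<bullet> Q = fst P $ 1 * fst Q $ 1 + fst P $ 2 * fst Q $ 2 + snd P * snd Q"
  by (simp add: inner_prod_def inner_vec2)

text \<open>A square matrix has a nontrivial kernel iff its determinant vanishes; \<open>V\<close>
  carries homogeneous coordinates to \<open>real^3\<close>, where this is available.\<close>

lemma ex_orthogonal_iff_det3:
  "(\<exists>Q. Q \<noteq> 0 \<and> l1 \<bullet> Q = 0 \<and> l2 \<bullet> Q = 0 \<and> l3 \<bullet> Q = 0) \<longleftrightarrow> det3 l1 l2 l3 = 0"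
proof -
  define V :: "hpoint \<Rightarrow> real^3" where "V P = vector [fst P $ 1, fst P $ 2, snd P]" for P
  define M :: "real^3^3" where "M = vector [V l1, V l2, V l3]"
  have MV: "M *v V Q = 0 \<longleftrightarrow> l1 \<bullet> Q = 0 \<and> l2 \<bullet> Q = 0 \<and> l3 \<bullet> Q = 0" for Q
    by (simp add: M_def V_def vec_eq_iff forall_3 matrix_vector_mult_def sum_3 hinner)
  have V0: "V Q = 0 \<longleftrightarrow> Q = 0" for Q
    by (simp add: V_def vec_eq_iff forall_3 forall_2 prod_eq_iff)
  have "x = V (vector [x$1, x$2], x$3)" for x
    by (simp add: V_def vec_eq_iff forall_3)
  then have "(\<exists>x. x \<noteq> 0 \<and> M *v x = 0) \<longleftrightarrow> (\<exists>Q. V Q \<noteq> 0 \<and> M *v V Q = 0)"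
    by metis
  moreover have "det M = det3 l1 l2 l3"
    by (simp add: det_3 M_def V_def det3_def algebra_simps)
  ultimately show ?thesis
    using invertible_det_nz[of M] unfolding invertible_left_inverse matrix_left_invertible_ker MV V0
    by metis
qed

lemma hcollinear_iff_det3: "hcollinear P Q R \<longleftrightarrow> det3 P Q R = 0"
  unfolding hcollinear_def ex_orthogonal_iff_det3[symmetric]
  by (simp add: inner_commute)

lemma cx_add: "cx (u + v) = cx u + cx v" and cx_diff: "cx (u - v) = cx u - cx v"
  and cx_scaleR: "cx (k *\<^sub>R u) = k * cx u"
  by (simp_all add: cx_def complex_eq_iff)

lemma cx_eq_iff: "cx u = cx v \<longleftrightarrow> u = v"
  by (simp add: cx_def vec2_eq_iff)

lemma norm_cx: "norm (cx u) = norm u"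
  by (simp add: cx_def norm_eq_sqrt_inner[of u] inner_vec2 cmod_def power2_eq_square)

lemma cross2_cx: "cross2 u v = Im (cnj (cx u) * cx v)"
  by (simp add: cross2_def cx_def)

text \<open>In complex terms the reflection is \<open>u\<close> mapped to \<open>(w / |w|)^2\<close>
  times the conjugate of \<open>u\<close>; the denominator is cleared.\<close>

lemma cx_reflect: "cx (reflect_in w u) * (norm w)\<^sup>2 = (cx w)\<^sup>2 * cnj (cx u)" if "w \<noteq> 0"
proof -
  define n where "n = w \<bullet> w"
  have n: "n \<noteq> 0" "n = w$1 * w$1 + w$2 * w$2" using that by (auto simp: n_def inner_vec2[symmetric])
  have "cx (reflect_in w u) * n = 2 * (u \<bullet> w) * cx w - n * cx u"
    using n(1) by (simp add: reflect_in_def n_def[symmetric] cx_diff cx_scaleR field_simps)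
  also have "\<dots> = (cx w)\<^sup>2 * cnj (cx u)"
    by (simp add: cx_def complex_eq_iff inner_vec2 power2_eq_square n(2) algebra_simps)
  finally show ?thesis by (simp add: power2_norm_eq_inner n_def)
qed

text \<open>For unit complex numbers, \<open>(x + y)\<^sup>2 = x y |x + y|\<^sup>2\<close>.\<close>

lemma cx_bisector_dir:
  assumes "B \<noteq> A" "C \<noteq> A"
  shows "(cx (bisector_dir A B C))\<^sup>2 * (norm (B - A) * norm (C - A)) =
     (norm (bisector_dir A B C))\<^sup>2 * (cx (B - A) * cx (C - A))"
proof -
  define x y where "x = cx (sgn (B - A))" and "y = cx (sgn (C - A))"
  have "norm x = 1" "norm y = 1" using assms by (simp_all add: x_def y_def norm_cx norm_sgn)
  then have xy: "x * cnj x = 1" "y * cnj y = 1"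
    by (simp_all add: complex_norm_square[symmetric])
  have "(x + y)\<^sup>2 = (x + y) * cnj (x + y) * (x * y)" using xy by (simp add: power2_eq_square) algebra
  then have "(x + y)\<^sup>2 = (norm (x + y))\<^sup>2 * (x * y)" by (simp only: complex_norm_square)
  then have "(x + y)\<^sup>2 * (norm (B - A) * norm (C - A)) =
      (norm (x + y))\<^sup>2 * ((x * norm (B - A)) * (y * norm (C - A)))" by (simp add: mult_ac)
  moreover have "x * norm (B - A) = cx (B - A)" "y * norm (C - A) = cx (C - A)"
    using assms by (simp_all add: x_def y_def sgn_div_norm cx_scaleR)
  moreover have "cx (bisector_dir A B C) = x + y" by (simp add: bisector_dir_def cx_add x_def y_def)
  ultimately show ?thesis by (simp only: of_real_mult norm_cx[symmetric])
qed

text \<open>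
  Here \<open>a', b', \<dots>\<close> are the complex conjugates of \<open>a, b, \<dots>\<close>. The difference on the left is \<open>2 \<i>\<close> times the
  imaginary part that vanishes for isogonal lines at \<open>a\<close>; on the right the conjugacy form and its
  conjugate appear.
\<close>

lemma bisector_form_identity:
  fixes a b c a' b' c' p q p' q' s t r :: complex
  assumes "a * a' = r" "b * b' = r" "c * c' = r"
  shows "a * b * c * r * a *
      ((b' - a') * (c' - a') * (p - t * a) * (q - s * a) - (b - a) * (c - a) * (p' - t * a') * (q' - s * a'))
   = (b - a) * (c - a) *
     (a * b * c * (a' * b' * c' * p * q + r^2 * (s * p' + t * q') - r^2 * (a' + b' + c') * t * s)
      - r * a * (a * b * c * p' * q' + r^2 * (s * p + t * q) - r^2 * (a + b + c) * t * s))"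
    (is "_ * (?l1 - ?l2) = ?z * (?r1 - ?r2)")
proof -
  \<comment> \<open>On the circle \<open>x' = r / x\<close>, so a conjugated chord
    \<open>b' - a'\<close> equals \<open>r * (a - b) / (a * b)\<close>.\<close>
  have 1: "a * b * c * a * ((b' - a') * (c' - a')) = r^2 * ((b - a) * (c - a))"
  proof -
    have "a * b * (b' - a') = a * (b * b') - b * (a * a')"
      "a * c * (c' - a') = a * (c * c') - c * (a * a')"
      by (simp_all add: algebra_simps)
    then have "a * b * (b' - a') = r * (a - b)" "a * c * (c' - a') = r * (a - c)"
      unfolding assms by (simp_all add: algebra_simps)
    then have "(a * b * (b' - a')) * (a * c * (c' - a')) = (r * (a - b)) * (r * (a - c))" by simp
    then show ?thesis by (simp add: algebra_simps power2_eq_square)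
  qed
  have "(a * a') * (b * b') * (c * c') = r^3" using assms by (simp add: power3_eq_cube)
  then have 2: "a * b * c * (a' * b' * c') = r^3" by (simp add: mult_ac)
  have "a * b * c * (a' + b' + c') = (a * a') * (b * c) + (b * b') * (c * a) + (c * c') * (a * b)"
    by (simp add: algebra_simps)
  then have 3: "a * b * c * (a' + b' + c') = r * (b * c + c * a + a * b)"
    unfolding assms by (simp add: algebra_simps)
  have "?r1 = (a * b * c * (a' * b' * c')) * (p * q) + r^2 * (a * b * c) * (s * p' + t * q')
      - r^2 * (a * b * c * (a' + b' + c')) * t * s"
    by (simp add: algebra_simps)
  then have r1: "?r1 = r^3 * (p * q) + r^2 * (a * b * c) * (s * p' + t * q')
      - r^3 * (b * c + c * a + a * b) * t * s"
    unfolding 2 3 by (simp add: power2_eq_square power3_eq_cube)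
  have l2: "r * a * (a * b * c) * ((p' - t * a') * (q' - s * a')) =
      r * a * (a * b * c) * p' * q' - r^2 * (a * b * c) * (s * p' + t * q') + r^3 * (b * c) * t * s"
    by (simp add: assms(1)[symmetric] algebra_simps power2_eq_square power3_eq_cube)
  have distrib: "e * r * a * (z' * x * y - z * x' * y') = r * (e * a * z') * (x * y) - z * (r * a * e * (x' * y'))"
    for e z' x y z x' y' :: complex
    by (simp add: algebra_simps)
  have "a * b * c * r * a * (?l1 - ?l2) = r * (r^2 * ?z) * ((p - t * a) * (q - s * a))
      - ?z * (r * a * (a * b * c) * ((p' - t * a') * (q' - s * a')))"
    unfolding distrib 1 ..
  also have "\<dots> = ?z * (r^3 * ((p - t * a) * (q - s * a))
      - r * a * (a * b * c) * ((p' - t * a') * (q' - s * a')))"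
    unfolding right_diff_distrib[of ?z] by (simp only: power2_eq_square power3_eq_cube mult_ac)
  also have "r^3 * ((p - t * a) * (q - s * a)) - r * a * (a * b * c) * ((p' - t * a') * (q' - s * a'))
      = ?r1 - ?r2"
    unfolding r1 l2 by (simp add: algebra_simps power2_eq_square power3_eq_cube)
  finally show ?thesis .
qed

text \<open>Two internal bisectors are never parallel: the products of unit side vectors are all
  positive multiples of the same cross product, or zero.\<close>

lemma cross2_bisector_dir:
  assumes "\<not> collinear {A, B, C}"
  shows "cross2 (bisector_dir A B C) (bisector_dir B C A) \<noteq> 0"
proof -
  define a b c where "a = norm (C - B)" and "b = norm (C - A)" and "c = norm (B - A)"
  have "B \<noteq> A" "C \<noteq> A" "C \<noteq> B" using assms by (auto simp: insert_commute)
  then have pos: "a > 0" "b > 0" "c > 0" by (auto simp: a_def b_def c_def)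
  have "cross2 (bisector_dir A B C) (bisector_dir B C A) =
      (1 / (a * b) + 1 / (b * c) + 1 / (c * a)) * cross2 (B - A) (C - A)"
    using pos unfolding bisector_dir_def sgn_div_norm
    by (simp add: norm_minus_commute[of A] a_def[symmetric] b_def[symmetric] c_def[symmetric])
       (simp add: cross2_def field_simps)
  moreover have "1 / (a * b) + 1 / (b * c) + 1 / (c * a) > 0" using pos by (simp add: add_pos_pos)
  ultimately show ?thesis using assms by (simp add: collinear_iff_cross2)
qed

lemma bisector_dir_nonzero: "bisector_dir A B C \<noteq> 0" if "\<not> collinear {A, B, C}"
  using cross2_bisector_dir[OF that] by (auto simp: cross2_def)

text \<open>The reflection involves the bisector \<open>w\<close> only through its square, a
  positive multiple of the product \<open>z\<close> of the side vectors. So no side lengths remain: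
  the condition is that \<open>u * v / z\<close> is real.\<close>

lemma isogonal_at_iff_cx:
  assumes "\<not> collinear {A, B, C}"
  shows "isogonal_at A B C P Q \<longleftrightarrow>
    Im (cnj (cx (B - A) * cx (C - A)) * (cx (dir_from A P) * cx (dir_from A Q))) = 0"
proof -
  define w u v R z where "w = bisector_dir A B C" and "u = dir_from A P" and "v = dir_from A Q"
    and "R = cx (reflect_in w u)" and "z = cx (B - A) * cx (C - A)"
  define n where "n = norm (B - A) * norm (C - A)"
  have ne: "B \<noteq> A" "C \<noteq> A" using assms by (auto simp: insert_commute)
  then have n: "n > 0" by (simp add: n_def)
  have w: "w \<noteq> 0" using bisector_dir_nonzero[OF assms] by (simp add: w_def)
  have "R * (norm w)\<^sup>2 = (cx w)\<^sup>2 * cnj (cx u)" unfolding R_def by (rule cx_reflect[OF w])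
  moreover have "(cx w)\<^sup>2 * n = (norm w)\<^sup>2 * z"
    using cx_bisector_dir[OF ne] by (simp add: w_def n_def z_def)
  ultimately have "(norm w)\<^sup>2 * (R * n) = (norm w)\<^sup>2 * (z * cnj (cx u))"
    by (metis mult.assoc mult.commute)
  then have "R * n = z * cnj (cx u)" using w by simp
  then have "n * (cnj R * cx v) = cnj z * (cx u * cx v)"
    by (metis (no_types, lifting) complex_cnj_cnj complex_cnj_complex_of_real complex_cnj_mult
        mult.assoc mult.commute)
  then have "n * Im (cnj R * cx v) = Im (cnj z * (cx u * cx v))"
    by (metis Im_complex_of_real Re_complex_of_real add.right_neutral mult_zero_left times_complex.simps(2))
  then show ?thesis using n
    by (simp only: isogonal_at_def collinear_0_iff_cross2 cross2_cx w_def[symmetric] u_def[symmetric]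
       v_def[symmetric] R_def[symmetric] z_def[symmetric]) (metis mult_eq_0_iff less_irrefl)
qed

section \<open>Isogonal conjugacy in circumcentric coordinates\<close>

definition shift :: "real^2 \<Rightarrow> hpoint \<Rightarrow> hpoint" where
  "shift X P = (fst P - snd P *\<^sub>R X, snd P)"

text \<open>
  For a triangle \<open>a, b, c\<close> inscribed in the circle of radius \<open>R\<close> about \<open>0\<close>, with \<open>h = a + b + c\<close>,
  \<open>g = a b c\<close> and \<open>k = R\<^sup>4\<close>, the isogonal conjugates \<open>p, q\<close> (projectively \<open>(p, t), (q, s)\<close>) are the
  zeros of this complex-valued symmetric bilinear form.
\<close>

definition conjugacy_form :: "real \<Rightarrow> real^2 \<Rightarrow> complex \<Rightarrow> hpoint \<Rightarrow> hpoint \<Rightarrow> complex" where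
  "conjugacy_form k h g P Q = g * cnj (cx (fst P)) * cnj (cx (fst Q))
      + k * (of_real (snd Q) * cx (fst P) + of_real (snd P) * cx (fst Q))
      - k * cx h * of_real (snd P) * of_real (snd Q)"

text \<open>For fixed \<open>P\<close> the conjugacy form is real linear in \<open>Q\<close>; this
  vector and \<open>conjugacy_im\<close> represent its real and imaginary parts as inner products
  with \<open>Q\<close>.\<close>

definition conjugacy_re :: "real \<Rightarrow> real^2 \<Rightarrow> complex \<Rightarrow> hpoint \<Rightarrow> hpoint" where
  "conjugacy_re k h g P =
     (vector [Re (g * cnj (cx (fst P))) + k * snd P, Im (g * cnj (cx (fst P)))],
      k * (fst P $ 1 - snd P * h $ 1))"

definition conjugacy_im :: "real \<Rightarrow> real^2 \<Rightarrow> complex \<Rightarrow> hpoint \<Rightarrow> hpoint" where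
  "conjugacy_im k h g P =
     (vector [Im (g * cnj (cx (fst P))), k * snd P - Re (g * cnj (cx (fst P)))],
      k * (fst P $ 2 - snd P * h $ 2))"

text \<open>The cross product of \<open>R^3\<close>: the coefficients of the line through two
  distinct points.\<close>

definition hcross :: "hpoint \<Rightarrow> hpoint \<Rightarrow> hpoint" where
  "hcross P Q =
     (vector [fst P $ 2 * snd Q - snd P * fst Q $ 2, snd P * fst Q $ 1 - fst P $ 1 * snd Q],
      fst P $ 1 * fst Q $ 2 - fst P $ 2 * fst Q $ 1)"

text \<open>
  The point \<open>(- h, 1)\<close> is the de Longchamps point, so this determinant vanishes iff the three linear
  conditions on a conjugate of \<open>P\<close> collinear with \<open>P\<close> and the de Longchamps point have a nonzero solution.
\<close>

definition darboux_form :: "real \<Rightarrow> real^2 \<Rightarrow> complex \<Rightarrow> hpoint \<Rightarrow> real" where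
  "darboux_form k h g P = det3 (conjugacy_re k h g P) (conjugacy_im k h g P) (hcross (- h, 1) P)"

lemma inner_hcross: "hcross P Q \<bullet> R = det3 P Q R"
  by (simp add: hcross_def det3_def hinner algebra_simps)

lemma det3_shift: "det3 (shift X P) (shift X Q) (shift X R) = det3 P Q R"
  by (simp add: shift_def det3_def algebra_simps)

lemma shift_eq_0_iff: "shift X P = 0 \<longleftrightarrow> P = 0"
  by (auto simp: shift_def prod_eq_iff)

lemma shift_shift: "shift X (shift (- X) P) = P"
  by (auto simp: shift_def prod_eq_iff)

lemma inner_conjugacy_re: "conjugacy_re k h g P \<bullet> Q = Re (conjugacy_form k h g P Q)"
 and inner_conjugacy_im: "conjugacy_im k h g P \<bullet> Q = Im (conjugacy_form k h g P Q)"
  by (simp_all add: conjugacy_re_def conjugacy_im_def conjugacy_form_def hinner cx_def algebra_simps)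

text \<open>By \<open>bisector_form_identity\<close>, up to nonzero factors. Since \<open>r\<close>,
  \<open>g\<close> and \<open>\<psi>\<close> are symmetric in the vertices, the chosen vertex enters
  only through the factor \<open>cx (A - X)\<close>.\<close>

lemma isogonal_at_iff_conjugacy_form:
  fixes P Q :: hpoint
  assumes nc: "\<not> collinear {A, B, C}" and O: "dist X A = dist X B" "dist X B = dist X C"
  defines "r \<equiv> (norm (A - X))\<^sup>2"
   and "g \<equiv> cx (A - X) * cx (B - X) * cx (C - X)" and "h \<equiv> (A - X) + (B - X) + (C - X)"
 defines "\<psi> \<equiv> conjugacy_form (r^2) h g (shift X P) (shift X Q)"
  shows "r \<noteq> 0" and "g \<noteq> 0" and "isogonal_at A B C P Q \<longleftrightarrow> g * cnj \<psi> = r * cx (A - X) * \<psi>"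
proof -
  define a b c where "a = cx (A - X)" and "b = cx (B - X)" and "c = cx (C - X)"
  have ne: "A \<noteq> B" "A \<noteq> C" using nc by (auto simp: insert_commute)
  have nz: "A \<noteq> X" "B \<noteq> X" "C \<noteq> X" using O ne by auto
  then show r: "r \<noteq> 0" by (simp add: r_def)
  have cx0: "cx u = 0 \<longleftrightarrow> u = 0" for u
    using norm_cx[of u] by (metis norm_eq_zero)
  have abc: "a \<noteq> 0" "b \<noteq> 0" "c \<noteq> 0" using nz by (auto simp: a_def b_def c_def cx0)
  then show g: "g \<noteq> 0" by (simp add: g_def a_def b_def c_def)
  have n: "a * cnj a = r" "b * cnj b = r" "c * cnj c = r"
    using O by (simp_all add: a_def b_def c_def r_def norm_cx dist_norm norm_minus_commute complex_norm_square[symmetric])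
  define z u v where "z = cx (B - A) * cx (C - A)" and "u = cx (dir_from A P)" and "v = cx (dir_from A Q)"
  have z: "z = (b - a) * (c - a)" by (simp add: z_def a_def b_def c_def cx_diff[symmetric])
  have "z \<noteq> 0" using ne by (simp add: z_def cx0)
  define p q t s where "p = cx (fst (shift X P))" and "q = cx (fst (shift X Q))" and "t = snd P" and "s = snd Q"
  have u: "u = p - t * a" by (simp add: u_def p_def t_def a_def dir_from_def shift_def cx_diff cx_scaleR algebra_simps)
  have v: "v = q - s * a" by (simp add: v_def q_def s_def a_def dir_from_def shift_def cx_diff cx_scaleR algebra_simps)
  have \<psi>: "\<psi> = a * b * c * cnj p * cnj q + r^2 * (s * p + t * q) - r^2 * (a + b + c) * t * s"
    by (simp only: \<psi>_def conjugacy_form_def g_def h_def a_def b_def c_def p_def q_def s_def t_def cx_add shift_def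
        fst_conv snd_conv of_real_power)
  have "a * b * c * r * a * (cnj z * (u * v) - cnj (cnj z * (u * v))) = z * (g * cnj \<psi> - r * a * \<psi>)"
    using bisector_form_identity[OF n, of p t q s "cnj p" "cnj q"]
    unfolding u v z \<psi> g_def a_def[symmetric] b_def[symmetric] c_def[symmetric]
    by (simp add: mult.assoc)
  moreover have Im_iff: "Im x = 0 \<longleftrightarrow> x - cnj x = 0" for x
    by (simp add: complex_eq_iff)
  moreover have "Im (cnj z * (u * v)) = 0 \<longleftrightarrow> cnj z * (u * v) - cnj (cnj z * (u * v)) = 0"
    using Im_iff[of "cnj z * (u * v)"] .
  ultimately show "isogonal_at A B C P Q \<longleftrightarrow> g * cnj \<psi> = r * cx (A - X) * \<psi>"
    using abc r \<open>z \<noteq> 0\<close>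
    unfolding isogonal_at_iff_cx[OF nc] z_def[symmetric] u_def[symmetric] v_def[symmetric] a_def[symmetric]
    by (metis mult_eq_0_iff of_real_eq_0_iff right_minus_eq)
qed

text \<open>The conditions at \<open>A\<close> and \<open>B\<close> have the same left-hand side, so
  they give \<open>r * a * \<psi> = r * b * \<psi>\<close>; as \<open>a\<close> and \<open>b\<close>
  differ, \<open>\<psi> = 0\<close>. Conversely \<open>\<psi> = 0\<close> gives all three.\<close>

lemma isogonal_iff_conjugacy_form:
  assumes nc: "\<not> collinear {A, B, C}" and O: "dist X A = dist X B" "dist X B = dist X C"
  shows "isogonal A B C P Q \<longleftrightarrow> P \<noteq> 0 \<and> Q \<noteq> 0 \<and>
     conjugacy_form (((norm (A - X))\<^sup>2)\<^sup>2) ((A - X) + (B - X) + (C - X)) (cx (A - X) * cx (B - X) * cx (C - X))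
       (shift X P) (shift X Q) = 0"
proof -
  define r g h where "r = (norm (A - X))\<^sup>2"
   and "g = cx (A - X) * cx (B - X) * cx (C - X)" and "h = (A - X) + (B - X) + (C - X)"
  define \<psi> where "\<psi> = conjugacy_form (r^2) h g (shift X P) (shift X Q)"
  have nc': "\<not> collinear {B, C, A}" "\<not> collinear {C, A, B}" using nc by (simp_all add: insert_commute)
  have eqs: "(norm (B - X))\<^sup>2 = r" "(norm (C - X))\<^sup>2 = r"
    "(B - X) + (C - X) + (A - X) = h" "(C - X) + (A - X) + (B - X) = h"
    "cx (B - X) * cx (C - X) * cx (A - X) = g" "cx (C - X) * cx (A - X) * cx (B - X) = g"
    using O by (simp_all add: r_def g_def h_def dist_norm norm_minus_commute)
  have O': "dist X C = dist X A" using O by simp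
  note i1 = isogonal_at_iff_conjugacy_form(3)[OF nc O, where P = P and Q = Q, folded r_def g_def h_def, folded \<psi>_def]
  note i2 = isogonal_at_iff_conjugacy_form(3)[OF nc'(1) O(2) O', where P = P and Q = Q, unfolded eqs, folded \<psi>_def]
  note i3 = isogonal_at_iff_conjugacy_form(3)[OF nc'(2) O' O(1), where P = P and Q = Q, unfolded eqs, folded \<psi>_def]
  have "cx (A - X) \<noteq> cx (B - X)" using nc by (auto simp: cx_eq_iff)
  then have "isogonal_at A B C P Q \<and> isogonal_at B C A P Q \<and> isogonal_at C A B P Q \<longleftrightarrow> \<psi> = 0"
    using isogonal_at_iff_conjugacy_form(1,2)[OF nc O] unfolding r_def[symmetric] g_def[symmetric] i1 i2 i3 by auto
  then show ?thesis unfolding isogonal_def \<psi>_def r_def g_def h_def by blast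
qed

section \<open>Central symmetry and nonvanishing of the Darboux form\<close>

lemma darboux_form_uminus: "darboux_form k h g (- X, t) = - darboux_form k h g (X, t)"
  unfolding darboux_form_def conjugacy_re_def conjugacy_im_def hcross_def det3_def cx_def
  by simp algebra

text \<open>The restriction to the line at infinity, i.e. the leading terms, is enough to see that
  the form is not identically zero.\<close>

lemma darboux_form_infinity:
  "darboux_form k h g (X, 0) = k * Im (g * cnj (cx X) ^ 3) - (norm g * norm X)\<^sup>2 * Im (cx h * cnj (cx X))"
  unfolding darboux_form_def conjugacy_re_def conjugacy_im_def hcross_def det3_def cx_def power_mult_distrib
    cmod_power2 power2_norm_eq_inner inner_vec2
  by (simp add: power3_eq_cube power2_eq_square) algebra

text \<open>Were the form zero, the harmonic cubic \<open>Im (g * cnj (cx X) ^ 3)\<close> would be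
  divisible by \<open>x^2 + y^2\<close>, which forces \<open>g = 0\<close>. Four directions suffice
  to see this.\<close>

lemma darboux_form_nonzero:
  assumes "k \<noteq> 0" "g \<noteq> 0" shows "\<exists>P. darboux_form k h g P \<noteq> 0"
proof (rule ccontr)
  assume "\<not> ?thesis"
  then have *: "darboux_form k h g (vector [x, y], 0) = 0" for x y by blast
  define u v where "u = (norm g)\<^sup>2 * Re (cx h)" and "v = (norm g)\<^sup>2 * Im (cx h)"
  have norm_vec: "(norm (vector [x, y] :: real^2))\<^sup>2 = x\<^sup>2 + y\<^sup>2" for x y
    by (simp add: power2_norm_eq_inner inner_vec2)
       (simp add: power2_eq_square)
  define m n where "m = k * Re g" and "n = k * Im g"
  have "k * Im (g * cnj (Complex x y) ^ 3) = m * (y^3 - 3 * x^2 * y) + n * (x^3 - 3 * x * y^2)" for x y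
    by (simp add: m_def n_def power3_eq_cube power2_eq_square algebra_simps)
  moreover have "k * Im (g * cnj (Complex x y) ^ 3) = (x\<^sup>2 + y\<^sup>2) * (v * x - u * y)" for x y
    using *[of x y] unfolding darboux_form_infinity power_mult_distrib norm_vec
    by (simp add: u_def v_def cx_def algebra_simps)
  ultimately have **: "m * (y^3 - 3 * x^2 * y) + n * (x^3 - 3 * x * y^2) = (x\<^sup>2 + y\<^sup>2) * (v * x - u * y)"
    for x y by simp
  have "m = 0" "n = 0"
    using **[of 0 1] **[of 1 0] **[of 1 1] **[of "-1" 1] by simp_all
  then have "k * Re g = 0 \<and> k * Im g = 0" by (simp add: m_def n_def)
  then show False using assms by (simp add: complex_eq_iff)
qed

section \<open>The locus as a cubic curve\<close>

definition homogeneous_cubic :: "(hpoint \<Rightarrow> real) \<Rightarrow> bool" where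
  "homogeneous_cubic f \<longleftrightarrow> (\<exists>c. \<forall>P. f P = cubic_form c P)"

lemma homogeneous_cubic_add:
  assumes "homogeneous_cubic f" "homogeneous_cubic g"
  shows "homogeneous_cubic (\<lambda>P. f P + g P)"
proof -
  obtain c d where "\<forall>P. f P = cubic_form c P" "\<forall>P. g P = cubic_form d P"
    using assms by (auto simp: homogeneous_cubic_def)
  then have "\<forall>P. f P + g P = cubic_form (\<lambda>i j. c i j + d i j) P"
    by (simp add: cubic_form_def algebra_simps sum.distrib)
  then show ?thesis unfolding homogeneous_cubic_def by blast
qed

lemma homogeneous_cubic_diff:
  assumes "homogeneous_cubic f" "homogeneous_cubic g"
  shows "homogeneous_cubic (\<lambda>P. f P - g P)"
proof -
  obtain c d where "\<forall>P. f P = cubic_form c P" "\<forall>P. g P = cubic_form d P"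
    using assms by (auto simp: homogeneous_cubic_def)
  then have "\<forall>P. f P - g P = cubic_form (\<lambda>i j. c i j - d i j) P"
    by (simp add: cubic_form_def algebra_simps sum_subtractf)
  then show ?thesis unfolding homogeneous_cubic_def by blast
qed

lemma homogeneous_cubic_mult:
  fixes f g h :: "hpoint \<Rightarrow> real"
  assumes "linear f" "linear g" "linear h"
  shows "homogeneous_cubic (\<lambda>P. f P * (g P * h P))"
proof -
  \<comment> \<open>The coefficients are the coordinates of the vector representing
    \<open>f\<close>, namely the adjoint applied to \<open>1\<close>.\<close>
  have ex: "\<exists>x y z. \<forall>P. f P = x * fst P $ 1 + y * fst P $ 2 + z * snd P"
    if "linear f" for f :: "hpoint \<Rightarrow> real"
    using adjoint_works[OF that, of _ 1] by (metis hinner inner_commute inner_real_def mult.right_neutral)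
  obtain x1 y1 z1 where 1: "\<forall>P. f P = x1 * fst P $ 1 + y1 * fst P $ 2 + z1 * snd P"
    using ex[OF assms(1)] by blast
  obtain x2 y2 z2 where 2: "\<forall>P. g P = x2 * fst P $ 1 + y2 * fst P $ 2 + z2 * snd P"
    using ex[OF assms(2)] by blast
  obtain x3 y3 z3 where 3: "\<forall>P. h P = x3 * fst P $ 1 + y3 * fst P $ 2 + z3 * snd P"
    using ex[OF assms(3)] by blast
  \<comment> \<open>The expanded product, sorted by monomials; values with \<open>i + j > 3\<close>
    never enter the sum.\<close>
  define c where "c i j =
    (if i = 3 then x1 * x2 * x3
     else if i = 2 then if j = 1 then x1 * x2 * y3 + x1 * y2 * x3 + y1 * x2 * x3
                        else x1 * x2 * z3 + x1 * z2 * x3 + z1 * x2 * x3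
     else if i = 1 then if j = 2 then x1 * y2 * y3 + y1 * x2 * y3 + y1 * y2 * x3
                        else if j = 1 then x1 * y2 * z3 + x1 * z2 * y3 + y1 * x2 * z3 + y1 * z2 * x3
                                         + z1 * x2 * y3 + z1 * y2 * x3
                        else x1 * z2 * z3 + z1 * x2 * z3 + z1 * z2 * x3
     else if j = 3 then y1 * y2 * y3
     else if j = 2 then y1 * y2 * z3 + y1 * z2 * y3 + z1 * y2 * y3
     else if j = 1 then y1 * z2 * z3 + z1 * y2 * z3 + z1 * z2 * y3
     else z1 * z2 * z3)" for i j :: nat
  have "f P * (g P * h P) = cubic_form c P" for P
    unfolding 1[rule_format] 2[rule_format] 3[rule_format]
    by (simp add: cubic_form_def c_def eval_nat_numeral atMost_Suc algebra_simps)
  then show ?thesis unfolding homogeneous_cubic_def by blast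
qed

text \<open>The expanded determinant is a signed sum of products of three linear forms.\<close>

lemma homogeneous_cubic_det3:
  assumes "linear F" "linear G" "linear H"
  shows "homogeneous_cubic (\<lambda>P. det3 (F P) (G P) (H P))"
proof -
  have "linear (\<lambda>P. fst (F P) $ i)" "linear (\<lambda>P. snd (F P))" if "linear F" for F :: "hpoint \<Rightarrow> hpoint" and i
    using linear_compose[OF that linear_fst] linear_compose[OF that linear_snd]
      linear_compose[OF _ bounded_linear.linear[OF bounded_linear_vec_nth]] by (auto simp: o_def)
  then show ?thesis using assms
    unfolding det3_def right_diff_distrib
    by (intro homogeneous_cubic_add homogeneous_cubic_diff homogeneous_cubic_mult) auto
qed

lemma cubic_curve_homogeneous_cubic:
  assumes "homogeneous_cubic f" "\<exists>P. f P \<noteq> 0"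
  shows "cubic_curve {P. P \<noteq> 0 \<and> f P = 0}"
proof -
  obtain c where c: "\<forall>P. f P = cubic_form c P" using assms(1) by (auto simp: homogeneous_cubic_def)
  have "\<exists>i j. i + j \<le> 3 \<and> c i j \<noteq> 0"
  proof (rule ccontr)
    assume "\<not> ?thesis"
    then have "c i j = 0" if "i \<le> 3" "j \<le> 3 - i" for i j
      using that by (metis Nat.le_diff_conv2 add.commute)
    then have "cubic_form c P = 0" for P by (simp add: cubic_form_def)
    then show False using assms(2) c by simp
  qed
  moreover have "f = cubic_form c" using c by blast
  ultimately show ?thesis unfolding cubic_curve_def by blast
qed

lemma det3_rotate: "det3 P Q R = det3 R P Q"
  by (simp add: det3_def algebra_simps)

text \<open>This eliminates \<open>Q\<close> from the locus condition. The point
  \<open>X - h\<close> will be the de Longchamps point.\<close>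

lemma darboux_locus_iff:
  assumes nc: "\<not> collinear {A, B, C}" and O: "dist X A = dist X B" "dist X B = dist X C"
  defines "k \<equiv> ((norm (A - X))\<^sup>2)\<^sup>2" and "h \<equiv> (A - X) + (B - X) + (C - X)"
    and "g \<equiv> cx (A - X) * cx (B - X) * cx (C - X)"
  shows "(\<exists>Q. isogonal A B C P Q \<and> hcollinear P Q (hpt (X - h))) \<longleftrightarrow>
    P \<noteq> 0 \<and> darboux_form k h g (shift X P) = 0"
proof -
  have L: "shift X (hpt (X - h)) = (- h, 1)" by (simp add: shift_def hpt_def)
  have col: "hcollinear P Q (hpt (X - h)) \<longleftrightarrow> hcross (- h, 1) (shift X P) \<bullet> shift X Q = 0" for Q
    unfolding hcollinear_iff_det3 inner_hcross L[symmetric] det3_shift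
    by (subst det3_rotate) (rule refl)
  have iso: "isogonal A B C P Q \<longleftrightarrow> P \<noteq> 0 \<and> shift X Q \<noteq> 0 \<and>
      conjugacy_re k h g (shift X P) \<bullet> shift X Q = 0 \<and> conjugacy_im k h g (shift X P) \<bullet> shift X Q = 0" for Q
    unfolding isogonal_iff_conjugacy_form[OF nc O] k_def[symmetric] h_def[symmetric] g_def[symmetric]
      shift_eq_0_iff inner_conjugacy_re inner_conjugacy_im complex_eq_iff by simp
  have "(\<exists>Q. isogonal A B C P Q \<and> hcollinear P Q (hpt (X - h))) \<longleftrightarrow>
    P \<noteq> 0 \<and> (\<exists>Q. Q \<noteq> 0 \<and> conjugacy_re k h g (shift X P) \<bullet> Q = 0 \<and> conjugacy_im k h g (shift X P) \<bullet> Q = 0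
        \<and> hcross (- h, 1) (shift X P) \<bullet> Q = 0)"
    \<comment> \<open>\<open>shift X\<close> is onto, so \<open>shift X Q\<close> may be replaced by
      an arbitrary point.\<close>
    unfolding iso col by (metis shift_shift)
  then show ?thesis unfolding ex_orthogonal_iff_det3 darboux_form_def .
qed

lemma linear_shift: "linear (shift X)"
  by (rule linearI) (auto simp: shift_def algebra_simps)

lemma linear_conjugacy_re: "linear (conjugacy_re k h g)"
  by (rule linearI) (auto simp: conjugacy_re_def cx_def vec2_eq_iff algebra_simps)

lemma linear_conjugacy_im: "linear (conjugacy_im k h g)"
  by (rule linearI) (auto simp: conjugacy_im_def cx_def vec2_eq_iff algebra_simps)

lemma linear_hcross: "linear (hcross P)"
  by (rule linearI) (auto simp: hcross_def vec2_eq_iff algebra_simps)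

lemma cubic_curve_darboux_form:
  assumes "k \<noteq> 0" "g \<noteq> 0"
  shows "cubic_curve {P. P \<noteq> 0 \<and> darboux_form k h g (shift X P) = 0}"
proof (rule cubic_curve_homogeneous_cubic)
  show "homogeneous_cubic (\<lambda>P. darboux_form k h g (shift X P))"
    unfolding darboux_form_def
    using homogeneous_cubic_det3[OF linear_compose[OF linear_shift linear_conjugacy_re]
      linear_compose[OF linear_shift linear_conjugacy_im] linear_compose[OF linear_shift linear_hcross]]
    by (simp add: o_def)
  show "\<exists>P. darboux_form k h g (shift X P) \<noteq> 0"
    using darboux_form_nonzero[OF assms] by (metis shift_shift)
qed

section \<open>Triangle centers\<close>

text \<open>Cramer's rule. Applied to a difference of two candidates, it yields the uniqueness
  needed for the definite descriptions of centers.\<close>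

lemma orthogonal_both_imp_zero:
  assumes "cross2 u v \<noteq> 0" "d \<bullet> u = 0" "d \<bullet> v = 0"
  shows "d = 0"
proof -
  have "cross2 u v * d$1 = (d \<bullet> u) * v$2 - (d \<bullet> v) * u$2" "cross2 u v * d$2 = (d \<bullet> v) * u$1 - (d \<bullet> u) * v$1"
    by (simp_all add: cross2_def inner_vec2 algebra_simps)
  then show ?thesis using assms by (simp add: vec2_eq_iff)
qed

lemma parallel_both_imp_zero:
  assumes "cross2 u v \<noteq> 0" "cross2 u d = 0" "cross2 v d = 0"
  shows "d = 0"
proof -
  have "cross2 u v * d$1 = cross2 u d * v$1 - cross2 v d * u$1"
    "cross2 u v * d$2 = cross2 u d * v$2 - cross2 v d * u$2"
    by (simp_all add: cross2_def algebra_simps)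
  then show ?thesis using assms by (simp add: vec2_eq_iff)
qed

lemma dist_eq_iff_inner: "dist P A = dist P B \<longleftrightarrow> 2 * ((P - A) \<bullet> (B - A)) = (B - A) \<bullet> (B - A)"
  for P :: "'a :: real_inner"
proof -
  have "dist P A = dist P B \<longleftrightarrow> (P - A) \<bullet> (P - A) = (P - B) \<bullet> (P - B)"
    by (simp add: dist_norm norm_eq)
  also have "\<dots> \<longleftrightarrow> 2 * ((P - A) \<bullet> (B - A)) = (B - A) \<bullet> (B - A)"
    by (simp add: inner_diff_left inner_diff_right inner_commute algebra_simps)
  finally show ?thesis .
qed

lemma circumcenter_eqI:
  assumes nc: "\<not> collinear {A, B, C}" and P: "dist P A = dist P B" "dist P B = dist P C"
  shows "circumcenter A B C = P"
  unfolding circumcenter_def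
proof (rule the_equality)
  fix Q assume Q: "dist Q A = dist Q B \<and> dist Q B = dist Q C"
  have "(Q - P) \<bullet> (B - A) = 0" "(Q - P) \<bullet> (C - A) = 0"
    using P Q dist_eq_iff_inner[of P A B] dist_eq_iff_inner[of P A C]
      dist_eq_iff_inner[of Q A B] dist_eq_iff_inner[of Q A C] by (simp_all add: inner_diff_left)
  then show "Q = P" using orthogonal_both_imp_zero[of "B - A" "C - A" "Q - P"] nc
    by (simp add: collinear_iff_cross2)
qed (use P in simp)

lemma dist_circumcenter:
  assumes "\<not> collinear {A, B, C}"
  shows "dist (circumcenter A B C) A = dist (circumcenter A B C) B"
    and "dist (circumcenter A B C) B = dist (circumcenter A B C) C"
proof -
  define u v where "u = B - A" and "v = C - A"
  define D where "D = cross2 u v"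
  have D: "D \<noteq> 0" using assms by (simp add: D_def u_def v_def collinear_iff_cross2)
  define m n where "m = u \<bullet> u" and "n = v \<bullet> v"
  \<comment> \<open>Cramer's solution of the two perpendicular bisector equations in the form of
    \<open>dist_eq_iff_inner\<close>.\<close>
  define P where "P = A + vector [(m * v$2 - n * u$2) / (2 * D), (n * u$1 - m * v$1) / (2 * D)]"
  have d: "2 * D * (P - A)$1 = m * v$2 - n * u$2" "2 * D * (P - A)$2 = n * u$1 - m * v$1"
    using D by (simp_all add: P_def)
  have "D * (2 * ((P - A) \<bullet> w)) = (2 * D * (P - A)$1) * w$1 + (2 * D * (P - A)$2) * w$2" for w
    unfolding inner_vec2[of "P - A"] by (simp only: algebra_simps)
  note inner = this[unfolded d]
  have "D * (2 * ((P - A) \<bullet> u)) = D * m" "D * (2 * ((P - A) \<bullet> v)) = D * n"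
    unfolding inner by (simp_all add: D_def cross2_def algebra_simps)
  then have "2 * ((P - A) \<bullet> u) = m" "2 * ((P - A) \<bullet> v) = n"
    using D mult_left_cancel[of D] by blast+
  then have PB: "dist P A = dist P B" and PC: "dist P A = dist P C"
    unfolding dist_eq_iff_inner u_def v_def m_def n_def by blast+
  have X: "circumcenter A B C = P" by (rule circumcenter_eqI[OF assms PB]) (simp only: PB[symmetric] PC)
  show "dist (circumcenter A B C) A = dist (circumcenter A B C) B" unfolding X by (rule PB)
  show "dist (circumcenter A B C) B = dist (circumcenter A B C) C" unfolding X by (simp only: PB[symmetric] PC)
qed

text \<open>With the circumcenter as origin the orthocenter is \<open>A + B + C\<close>: the sum of
  two vectors of equal length is orthogonal to their difference.\<close>

lemma orthocenter_eq_circumcenter: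
  assumes nc: "\<not> collinear {A, B, C}"
  shows "orthocenter A B C = A + B + C - 2 *\<^sub>R circumcenter A B C"
proof -
  define X where "X = circumcenter A B C"
  have orth: "(V + W - 2 *\<^sub>R X) \<bullet> (V - W) = 0" if "dist X V = dist X W" for V W :: "real^2"
    using that unfolding dist_eq_iff_inner by (simp add: inner_vec2 algebra_simps)
  define H where "H = A + B + C - 2 *\<^sub>R X"
  note d = dist_circumcenter[OF nc, folded X_def]
  have "H - A = B + C - 2 *\<^sub>R X" "H - B = C + A - 2 *\<^sub>R X" "H - C = A + B - 2 *\<^sub>R X"
    by (simp_all add: H_def)
  then have H: "(H - A) \<bullet> (B - C) = 0" "(H - B) \<bullet> (C - A) = 0" "(H - C) \<bullet> (A - B) = 0"
    using orth[of B C] orth[of C A] orth[of A B] d by simp_all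
  have "orthocenter A B C = H" unfolding orthocenter_def
  proof (rule the_equality)
    fix Q assume Q: "(Q - A) \<bullet> (B - C) = 0 \<and> (Q - B) \<bullet> (C - A) = 0 \<and> (Q - C) \<bullet> (A - B) = 0"
    have "(Q - H) \<bullet> (B - A) = 0" "(Q - H) \<bullet> (C - A) = 0"
      using Q H by (simp_all add: inner_diff_left inner_diff_right)
    then show "Q = H" using orthogonal_both_imp_zero[of "B - A" "C - A" "Q - H"] nc
      by (simp add: collinear_iff_cross2)
  qed (use H in simp)
  then show ?thesis by (simp add: H_def X_def)
qed

section \<open>Incenter and excenters\<close>

lemma incenter_eqI:
  assumes nc: "\<not> collinear {A, B, C}"
    and P: "cross2 (bisector_dir A B C) (P - A) = 0" "cross2 (bisector_dir B C A) (P - B) = 0"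
      "cross2 (bisector_dir C A B) (P - C) = 0"
  shows "incenter A B C = P"
  unfolding incenter_def collinear_0_iff_cross2
proof (rule the_equality)
  fix Q assume Q: "cross2 (bisector_dir A B C) (Q - A) = 0 \<and> cross2 (bisector_dir B C A) (Q - B) = 0 \<and>
      cross2 (bisector_dir C A B) (Q - C) = 0"
  have diff: "cross2 w (Q - P) = cross2 w (Q - V) - cross2 w (P - V)" for w V
    by (simp add: cross2_def algebra_simps)
  have "cross2 (bisector_dir A B C) (Q - P) = 0" "cross2 (bisector_dir B C A) (Q - P) = 0"
    using P Q by (simp add: diff[of _ A], simp add: diff[of _ B])
  then have "Q - P = 0" by (rule parallel_both_imp_zero[OF cross2_bisector_dir[OF nc]])
  then show "Q = P" by simp
qed (use P in simp)

lemma excenter_eqI: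
  assumes nc: "\<not> collinear {A, B, C}"
    and P: "cross2 (bisector_dir A B C) (P - A) = 0" "bisector_dir B C A \<bullet> (P - B) = 0"
      "bisector_dir C A B \<bullet> (P - C) = 0"
  shows "excenter A B C = P"
  unfolding excenter_def collinear_0_iff_cross2
proof (rule the_equality)
  fix Q assume Q: "cross2 (bisector_dir A B C) (Q - A) = 0 \<and> bisector_dir B C A \<bullet> (Q - B) = 0 \<and>
      bisector_dir C A B \<bullet> (Q - C) = 0"
  have "(Q - P) \<bullet> bisector_dir B C A = 0" "(Q - P) \<bullet> bisector_dir C A B = 0"
    using P Q by (simp_all add: inner_diff_left inner_diff_right inner_commute)
  moreover have "\<not> collinear {B, C, A}" using nc by (simp add: insert_commute)
  ultimately have "Q - P = 0" by (intro orthogonal_both_imp_zero[OF cross2_bisector_dir])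
  then show "Q = P" by simp
qed (use P in simp)

lemma scaled_bisector_dir:
  assumes "B \<noteq> A" "C \<noteq> A"
  shows "(norm (C - A) * norm (B - A)) *\<^sub>R bisector_dir A B C =
    norm (C - A) *\<^sub>R (B - A) + norm (B - A) *\<^sub>R (C - A)"
  using assms by (simp add: bisector_dir_def sgn_div_norm scaleR_add_right field_simps)

text \<open>Equality would make two sides parallel. Strictness keeps the denominators for the
  excenters positive.\<close>

lemma norm_triangle_strict:
  fixes A B C :: "real^2"
  assumes nc: "\<not> collinear {A, B, C}"
  shows "norm (C - B) < norm (C - A) + norm (B - A)"
proof -
  have "norm ((C - A) + (A - B)) \<noteq> norm (C - A) + norm (A - B)"
  proof
    assume "norm ((C - A) + (A - B)) = norm (C - A) + norm (A - B)"
    then have "norm (C - A) *\<^sub>R (A - B) = norm (A - B) *\<^sub>R (C - A)"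
      by (simp only: norm_triangle_eq)
    then have "cross2 (norm (C - A) *\<^sub>R (A - B)) (C - A) = cross2 (norm (A - B) *\<^sub>R (C - A)) (C - A)"
      by simp
    then have "norm (C - A) * cross2 (B - A) (C - A) = 0" by (simp add: cross2_def algebra_simps)
    then show False using nc by (auto simp: collinear_iff_cross2 cross2_def)
  qed
  then show ?thesis using norm_triangle_ineq[of "C - A" "A - B"] by (simp add: norm_minus_commute)
qed

lemma incenter_bisector:
  assumes nc: "\<not> collinear {A, B, C}"
  shows "incenter A B C - A =
    (norm (C - A) * norm (B - A) / (norm (C - B) + norm (C - A) + norm (B - A))) *\<^sub>R bisector_dir A B C"
    and "incenter B C A = incenter A B C"
proof -
  define a b c where "a = norm (C - B)" and "b = norm (C - A)" and "c = norm (B - A)"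
  have norms: "norm (B - C) = a" "norm (A - C) = b" "norm (A - B) = c"
    by (simp_all add: a_def b_def c_def norm_minus_commute)
  note abc = a_def[symmetric] b_def[symmetric] c_def[symmetric] norms
  have ne: "B \<noteq> A" "C \<noteq> A" "C \<noteq> B" using nc by (auto simp: insert_commute)
  then have "a > 0" "b > 0" "c > 0" by (simp_all add: a_def b_def c_def)
  define s where "s = a + b + c"
  have s: "s \<noteq> 0" using \<open>a > 0\<close> \<open>b > 0\<close> \<open>c > 0\<close> by (simp add: s_def)
  \<comment> \<open>The point with barycentric coordinates \<open>a : b : c\<close>. It is symmetric
    in the vertices, so it also serves for the rotated triangle.\<close>
  define P where "P = (1 / s) *\<^sub>R (a *\<^sub>R A + b *\<^sub>R B + c *\<^sub>R C)"
  have PV: "P - V = (1 / s) *\<^sub>R (a *\<^sub>R A + b *\<^sub>R B + c *\<^sub>R C - s *\<^sub>R V)" for V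
    using s by (simp add: P_def scaleR_diff_right)
  have "a *\<^sub>R A + b *\<^sub>R B + c *\<^sub>R C - s *\<^sub>R A = b *\<^sub>R (B - A) + c *\<^sub>R (C - A)"
    "a *\<^sub>R A + b *\<^sub>R B + c *\<^sub>R C - s *\<^sub>R B = c *\<^sub>R (C - B) + a *\<^sub>R (A - B)"
    "a *\<^sub>R A + b *\<^sub>R B + c *\<^sub>R C - s *\<^sub>R C = a *\<^sub>R (A - C) + b *\<^sub>R (B - C)"
    unfolding s_def by (simp_all add: algebra_simps)
  note diffs = this[THEN arg_cong[where f = "(*\<^sub>R) (1 / s)"], folded PV]
  have P: "P - A = (b * c / s) *\<^sub>R bisector_dir A B C" "P - B = (c * a / s) *\<^sub>R bisector_dir B C A"
    "P - C = (a * b / s) *\<^sub>R bisector_dir C A B"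
    unfolding diffs using ne
    by (simp_all flip: scaled_bisector_dir[of B A C, unfolded abc] scaled_bisector_dir[of C B A, unfolded abc]
        scaled_bisector_dir[of A C B, unfolded abc])
  have *: "cross2 w (k *\<^sub>R w) = 0" for k w by (simp add: cross2_def)
  have I: "incenter A B C = P" by (rule incenter_eqI[OF nc]) (simp_all only: P *)
  show "incenter A B C - A =
    (norm (C - A) * norm (B - A) / (norm (C - B) + norm (C - A) + norm (B - A))) *\<^sub>R bisector_dir A B C"
    unfolding I P abc s_def ..
  have "\<not> collinear {B, C, A}" using nc by (simp add: insert_commute)
  then show "incenter B C A = incenter A B C"
    unfolding I by (rule incenter_eqI) (simp_all only: P *)
qed

lemma excenter_bisector:
  assumes nc: "\<not> collinear {A, B, C}"
  shows "excenter A B C - A =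
    (norm (C - A) * norm (B - A) / (norm (C - A) + norm (B - A) - norm (C - B))) *\<^sub>R bisector_dir A B C"
    and "bisector_dir B C A \<bullet> (excenter A B C - B) = 0"
    and "bisector_dir C A B \<bullet> (excenter A B C - C) = 0"
proof -
  define a b c where "a = norm (C - B)" and "b = norm (C - A)" and "c = norm (B - A)"
  have norms: "norm (B - C) = a" "norm (A - C) = b" "norm (A - B) = c"
    by (simp_all add: a_def b_def c_def norm_minus_commute)
  note abc = a_def[symmetric] b_def[symmetric] c_def[symmetric] norms
  have ne: "B \<noteq> A" "C \<noteq> A" "C \<noteq> B" using nc by (auto simp: insert_commute)
  then have pos: "a > 0" "b > 0" "c > 0" by (simp_all add: a_def b_def c_def)
  define s where "s = b + c - a"
  have s: "s \<noteq> 0" using norm_triangle_strict[OF nc] by (simp add: s_def a_def b_def c_def)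
  \<comment> \<open>The point with barycentric coordinates \<open>-a : b : c\<close>.\<close>
  define P where "P = (1 / s) *\<^sub>R (b *\<^sub>R B + c *\<^sub>R C - a *\<^sub>R A)"
  have PV: "P - V = (1 / s) *\<^sub>R (b *\<^sub>R B + c *\<^sub>R C - a *\<^sub>R A - s *\<^sub>R V)" for V
    using s by (simp add: P_def scaleR_diff_right)
  have "b *\<^sub>R B + c *\<^sub>R C - a *\<^sub>R A - s *\<^sub>R A = b *\<^sub>R (B - A) + c *\<^sub>R (C - A)"
    "b *\<^sub>R B + c *\<^sub>R C - a *\<^sub>R A - s *\<^sub>R B = c *\<^sub>R (C - B) - a *\<^sub>R (A - B)"
    "b *\<^sub>R B + c *\<^sub>R C - a *\<^sub>R A - s *\<^sub>R C = b *\<^sub>R (B - C) - a *\<^sub>R (A - C)"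
    unfolding s_def by (simp_all add: algebra_simps)
  note diffs = this[THEN arg_cong[where f = "(*\<^sub>R) (1 / s)"], folded PV]
  have P: "P - A = (b * c / s) *\<^sub>R bisector_dir A B C"
    unfolding diffs using ne by (simp flip: scaled_bisector_dir[of B A C, unfolded abc])
  \<comment> \<open>For nonzero vectors the second factor is a multiple of
    \<open>sgn u - sgn v\<close>, and sum and difference of unit vectors are orthogonal.\<close>
  have perp: "(sgn u + sgn v) \<bullet> (norm v *\<^sub>R u - norm u *\<^sub>R v) = 0" for u v :: "real^2"
  proof (cases "u = 0 \<or> v = 0")
    case False
    then show ?thesis
      by (simp add: sgn_div_norm inner_add_left inner_diff_right inner_commute[of v u]
          flip: power2_norm_eq_inner) (simp add: power2_eq_square field_simps)
  qed auto
  have PB: "bisector_dir B C A \<bullet> (P - B) = 0"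
    unfolding diffs using perp[of "C - B" "A - B"] by (simp add: bisector_dir_def abc)
  have PC: "bisector_dir C A B \<bullet> (P - C) = 0"
    unfolding diffs using perp[of "B - C" "A - C"] by (simp add: bisector_dir_def abc add.commute)
  have *: "cross2 w (k *\<^sub>R w) = 0" for k w by (simp add: cross2_def)
  have I: "excenter A B C = P" by (rule excenter_eqI[OF nc _ PB PC]) (simp only: P *)
  show "excenter A B C - A =
    (norm (C - A) * norm (B - A) / (norm (C - A) + norm (B - A) - norm (C - B))) *\<^sub>R bisector_dir A B C"
    unfolding I P abc s_def ..
  show "bisector_dir B C A \<bullet> (excenter A B C - B) = 0" "bisector_dir C A B \<bullet> (excenter A B C - C) = 0"
    unfolding I by fact+
qed

section \<open>Points on the Darboux cubic\<close>

definition darboux_locus :: "real^2 \<Rightarrow> real^2 \<Rightarrow> real^2 \<Rightarrow> hpoint set" where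
  "darboux_locus A B C = {P. \<exists>Q. isogonal A B C P Q \<and> hcollinear P Q (hpt (de_longchamps_point A B C))}"

definition darboux_fun :: "real^2 \<Rightarrow> real^2 \<Rightarrow> real^2 \<Rightarrow> hpoint \<Rightarrow> real" where
  "darboux_fun A B C P = (let X = circumcenter A B C in
     darboux_form (((norm (A - X))\<^sup>2)\<^sup>2) ((A - X) + (B - X) + (C - X))
       (cx (A - X) * cx (B - X) * cx (C - X)) (shift X P))"

lemma de_longchamps_point_eq:
  assumes "\<not> collinear {A, B, C}"
  defines "X \<equiv> circumcenter A B C"
  shows "de_longchamps_point A B C = X - ((A - X) + (B - X) + (C - X))"
  using orthocenter_eq_circumcenter[OF assms(1)]
  by (simp add: de_longchamps_point_def X_def[symmetric] vec2_eq_iff)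

lemma darboux_locus_eq:
  assumes nc: "\<not> collinear {A, B, C}"
  shows "darboux_locus A B C = {P. P \<noteq> 0 \<and> darboux_fun A B C P = 0}"
  unfolding darboux_locus_def de_longchamps_point_eq[OF nc] darboux_locus_iff[OF nc dist_circumcenter[OF nc]]
    darboux_fun_def Let_def ..

lemma cubic_curve_darboux_locus:
  assumes nc: "\<not> collinear {A, B, C}"
  shows "cubic_curve (darboux_locus A B C)"
  unfolding darboux_locus_eq[OF nc] darboux_fun_def Let_def
  using isogonal_at_iff_conjugacy_form(1,2)[OF nc dist_circumcenter[OF nc]]
  by (intro cubic_curve_darboux_form) simp_all

lemma hpt_nonzero: "hpt X \<noteq> 0"
  by (simp add: hpt_def prod_eq_iff)

lemma darboux_locus_reflect:
  assumes nc: "\<not> collinear {A, B, C}" and P: "hpt P \<in> darboux_locus A B C"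
  shows "hpt (2 *\<^sub>R circumcenter A B C - P) \<in> darboux_locus A B C"
proof -
  define X where "X = circumcenter A B C"
  have "shift X (hpt (2 *\<^sub>R X - P)) = (- (P - X), 1)" "shift X (hpt P) = (P - X, 1)"
    by (simp_all add: shift_def hpt_def scaleR_2)
  then show ?thesis using P
    unfolding darboux_locus_eq[OF nc] darboux_fun_def Let_def X_def[symmetric]
    by (simp add: darboux_form_uminus hpt_nonzero del: minus_diff_eq)
qed

lemma isogonal_rotate: "isogonal B C A P Q \<longleftrightarrow> isogonal A B C P Q"
  by (auto simp: isogonal_def)

text \<open>Immediate from the symmetry of the conjugacy form in its two points.\<close>

lemma isogonal_commute:
  assumes nc: "\<not> collinear {A, B, C}"
  shows "isogonal A B C P Q \<longleftrightarrow> isogonal A B C Q P"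
  unfolding isogonal_iff_conjugacy_form[OF nc dist_circumcenter[OF nc]]
  by (auto simp: conjugacy_form_def algebra_simps)

lemma det3_same: "det3 P P Q = 0" "det3 P Q Q = 0"
  by (simp_all add: det3_def algebra_simps)

lemma self_isogonal_in_darboux_locus: "isogonal A B C P P \<Longrightarrow> P \<in> darboux_locus A B C"
  unfolding darboux_locus_def mem_Collect_eq hcollinear_iff_det3 by (intro exI[of _ P]) (simp add: det3_same)

text \<open>Reflection in a line maps every vector parallel or perpendicular to it to a multiple of
  itself.\<close>

lemma isogonal_at_self:
  assumes "cross2 (bisector_dir A B C) (P - A) = 0 \<or> bisector_dir A B C \<bullet> (P - A) = 0"
  shows "isogonal_at A B C (hpt P) (hpt P)"
proof -
  have "cross2 (reflect_in w u) u = 2 * (u \<bullet> w) / (w \<bullet> w) * cross2 w u" for w u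
    by (simp add: reflect_in_def cross2_def algebra_simps)
  then show ?thesis using assms
    by (auto simp: isogonal_at_def collinear_0_iff_cross2 dir_from_def hpt_def inner_commute)
qed

lemma not_collinear_rotate: "\<not> collinear {A, B, C} \<Longrightarrow> \<not> collinear {B, C, A}"
  by (simp add: insert_commute)

lemma incenter_self_isogonal:
  assumes nc: "\<not> collinear {A, B, C}"
  shows "isogonal A B C (hpt (incenter A B C)) (hpt (incenter A B C))"
proof -
  have self: "isogonal_at A B C (hpt (incenter A B C)) (hpt (incenter A B C))"
    if "\<not> collinear {A, B, C}" for A B C
    by (rule isogonal_at_self) (simp add: incenter_bisector[OF that] cross2_def)
  note nc' = not_collinear_rotate[OF nc]
  show ?thesis
    using self[OF nc] self[OF nc'] self[OF not_collinear_rotate[OF nc']]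
    by (simp add: isogonal_def hpt_nonzero incenter_bisector(2)[OF nc] incenter_bisector(2)[OF nc'])
qed

lemma excenter_self_isogonal:
  assumes nc: "\<not> collinear {A, B, C}"
  shows "isogonal A B C (hpt (excenter A B C)) (hpt (excenter A B C))"
  unfolding isogonal_def
proof (intro conjI isogonal_at_self hpt_nonzero)
  show "cross2 (bisector_dir A B C) (excenter A B C - A) = 0 \<or>
      bisector_dir A B C \<bullet> (excenter A B C - A) = 0"
    unfolding excenter_bisector(1)[OF nc] by (simp add: cross2_def)
qed (use excenter_bisector(2,3)[OF nc] in simp_all)

text \<open>Every point of the line \<open>BC\<close> is a conjugate of \<open>A\<close>, so one can
  be chosen collinear with \<open>A\<close> and the de Longchamps point.\<close>

lemma vertex_in_darboux_locus:
  assumes nc: "\<not> collinear {A, B, C}"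
  shows "hpt A \<in> darboux_locus A B C"
proof -
  define L where "L = hpt (de_longchamps_point A B C)"
  \<comment> \<open>\<open>Q\<close> is a common point of the lines \<open>BC\<close> and \<open>AL\<close>; the repeated row covers the case that they coincide.\<close>
  obtain Q where Q: "Q \<noteq> 0" "det3 (hpt B) (hpt C) Q = 0" "det3 (hpt A) L Q = 0"
    using ex_orthogonal_iff_det3[of "hcross (hpt B) (hpt C)" "hcross (hpt A) L" "hcross (hpt A) L"]
    by (auto simp: inner_hcross det3_same)
  have BC: "cross2 (C - B) (dir_from B Q) = 0" "cross2 (B - C) (dir_from C Q) = 0"
    using Q(2) by (simp_all add: det3_def hpt_def cross2_def dir_from_def algebra_simps)
  \<comment> \<open>At \<open>B\<close> and \<open>C\<close> the direction to the point
    \<open>hpt A\<close> is itself a side vector \<open>y\<close>; it cancels, leaving that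
    \<open>Q\<close> lies on \<open>BC\<close>.\<close>
  have im: "Im (cnj (x * y) * (y * z)) = (norm y)\<^sup>2 * Im (cnj x * z)" for x y z :: complex
    unfolding cmod_power2 by (simp add: power2_eq_square algebra_simps)
  have nc': "\<not> collinear {B, C, A}" "\<not> collinear {C, A, B}" using nc by (simp_all add: insert_commute)
  have "isogonal_at B C A (hpt A) Q"
    using BC(1) unfolding isogonal_at_iff_cx[OF nc'(1)] cross2_cx
    by (simp only: hpt_def dir_from_def fst_conv snd_conv scaleR_one im mult_zero_right)
  moreover have "isogonal_at C A B (hpt A) Q"
    using BC(2) unfolding isogonal_at_iff_cx[OF nc'(2)] cross2_cx mult.commute[of "cx (A - C)" "cx (B - C)"]
    by (simp only: hpt_def dir_from_def fst_conv snd_conv scaleR_one im mult_zero_right)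
  moreover have "isogonal_at A B C (hpt A) Q"
    by (simp add: isogonal_at_def hpt_def dir_from_def reflect_in_def)
  ultimately have "isogonal A B C (hpt A) Q" using Q(1) by (simp add: isogonal_def hpt_nonzero)
  moreover have "hcollinear (hpt A) Q L"
    using Q(3) by (simp add: hcollinear_iff_det3 det3_def algebra_simps)
  ultimately show ?thesis unfolding darboux_locus_def L_def by blast
qed

lemma darboux_locus_rotate:
  assumes nc: "\<not> collinear {A, B, C}"
  shows "darboux_locus B C A = darboux_locus A B C"
proof -
  have "circumcenter B C A = circumcenter A B C"
    using dist_circumcenter[OF nc] by (intro circumcenter_eqI[OF not_collinear_rotate[OF nc]]) simp_all
  then have "de_longchamps_point B C A = de_longchamps_point A B C"
    using orthocenter_eq_circumcenter[OF nc] orthocenter_eq_circumcenter[OF not_collinear_rotate[OF nc]]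
    by (simp add: de_longchamps_point_def add_ac)
  then show ?thesis unfolding darboux_locus_def isogonal_rotate[of B C A] by simp
qed

text \<open>For \<open>p = 0\<close>, \<open>t = 1\<close> the conjugacy form reduces to
  \<open>k * (q - s * h)\<close>, which vanishes at the orthocenter \<open>(h, 1)\<close>.\<close>

lemma circumcenter_isogonal_orthocenter:
  assumes nc: "\<not> collinear {A, B, C}"
  shows "isogonal A B C (hpt (circumcenter A B C)) (hpt (orthocenter A B C))"
proof -
  define X where "X = circumcenter A B C"
  have "shift X (hpt X) = (0, 1)"
    and "shift X (hpt (A + B + C - 2 *\<^sub>R X)) = ((A - X) + (B - X) + (C - X), 1)"
    by (simp_all add: shift_def hpt_def vec2_eq_iff)
  then show ?thesis
    unfolding isogonal_iff_conjugacy_form[OF nc dist_circumcenter[OF nc]] orthocenter_eq_circumcenter[OF nc] X_def[symmetric]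
    using cx_scaleR[of 0 0] by (simp add: hpt_nonzero conjugacy_form_def)
qed

lemma circumcenter_in_darboux_locus:
  assumes nc: "\<not> collinear {A, B, C}"
  shows "hpt (circumcenter A B C) \<in> darboux_locus A B C"
    and "hpt (orthocenter A B C) \<in> darboux_locus A B C"
proof -
  have "hcollinear (hpt X) (hpt H) (hpt (2 *\<^sub>R X - H))" "hcollinear (hpt H) (hpt X) (hpt (2 *\<^sub>R X - H))" for X H
    by (simp_all add: hcollinear_iff_det3 det3_def hpt_def algebra_simps)
  then show "hpt (circumcenter A B C) \<in> darboux_locus A B C"
    and "hpt (orthocenter A B C) \<in> darboux_locus A B C"
    using circumcenter_isogonal_orthocenter[OF nc] isogonal_commute[OF nc]
    unfolding darboux_locus_def de_longchamps_point_def by blast+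
qed

lemma de_longchamps_point_in_darboux_locus:
  assumes nc: "\<not> collinear {A, B, C}"
  shows "hpt (de_longchamps_point A B C) \<in> darboux_locus A B C"
    and "isogonal_conjugate A B C (hpt (de_longchamps_point A B C)) \<in> darboux_locus A B C"
proof -
  define L where "L = hpt (de_longchamps_point A B C)"
  show "hpt (de_longchamps_point A B C) \<in> darboux_locus A B C"
    unfolding de_longchamps_point_def
    by (rule darboux_locus_reflect[OF nc circumcenter_in_darboux_locus(2)[OF nc]])
  \<comment> \<open>Membership in the locus supplies the conjugate that the choice operator
    requires.\<close>
  then have "\<exists>Q. isogonal A B C L Q" unfolding darboux_locus_def L_def by blast
  then have "isogonal A B C L (isogonal_conjugate A B C L)"
    unfolding isogonal_conjugate_def by (rule someI_ex)
  then have "isogonal A B C (isogonal_conjugate A B C L) L" using isogonal_commute[OF nc] by blast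
  moreover have "hcollinear (isogonal_conjugate A B C L) L L" by (simp add: hcollinear_iff_det3 det3_same)
  ultimately show "isogonal_conjugate A B C (hpt (de_longchamps_point A B C)) \<in> darboux_locus A B C"
    unfolding darboux_locus_def L_def by blast
qed

section \<open>The excentral triangle and the Bevan point\<close>

text \<open>The excenter lies on the internal bisector at \<open>A\<close> but is not
  \<open>A\<close>, hence it is off the external one. The other two excenters lie on the external
  one.\<close>

lemma excenter_neq:
  assumes nc: "\<not> collinear {A, B, C}" and P: "bisector_dir A B C \<bullet> (P - A) = 0"
  shows "P \<noteq> excenter A B C"
proof
  assume "P = excenter A B C"
  then have "(norm (C - A) * norm (B - A) / (norm (C - A) + norm (B - A) - norm (C - B))) *
      (bisector_dir A B C \<bullet> bisector_dir A B C) = 0"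
    using P by (simp add: excenter_bisector(1)[OF nc])
  moreover have "B \<noteq> A" "C \<noteq> A" using nc by (auto simp: insert_commute)
  ultimately show False using norm_triangle_strict[OF nc] bisector_dir_nonzero[OF nc] by simp
qed

lemma not_collinear_excenters:
  assumes nc: "\<not> collinear {A, B, C}"
  shows "\<not> collinear {excenter A B C, excenter B C A, excenter C A B}"
proof
  assume col: "collinear {excenter A B C, excenter B C A, excenter C A B}"
  note nc1 = not_collinear_rotate[OF nc]
  note nc2 = not_collinear_rotate[OF nc1]
  define d e where "d = excenter B C A - excenter A B C" and "e = excenter C A B - excenter A B C"
  define u v where "u = bisector_dir B C A" and "v = bisector_dir C A B"
  have nz: "d \<noteq> 0" "e \<noteq> 0"
    using excenter_neq[OF nc excenter_bisector(3)[OF nc1]] excenter_neq[OF nc excenter_bisector(2)[OF nc2]]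
    by (simp_all add: d_def e_def)
  have diff: "w \<bullet> (P - Q) = w \<bullet> (P - V) - w \<bullet> (Q - V)" for w P Q V :: "real^2"
    by (simp add: inner_diff_right)
  have "d \<bullet> v = 0" "e \<bullet> u = 0"
    using excenter_bisector(3)[OF nc] excenter_bisector(2)[OF nc1] excenter_bisector(2)[OF nc] excenter_bisector(3)[OF nc2]
    by (simp_all add: d_def e_def u_def v_def inner_commute[of "_ - _"] diff[of v _ _ C] diff[of u _ _ B]
      inner_diff_right)
  moreover have "cross2 d e = 0" using col by (simp add: collinear_iff_cross2 d_def e_def)
  \<comment> \<open>If the excenters were collinear, both terms on the right would vanish, so
    \<open>d\<close> would be orthogonal to \<open>u\<close> as well as to \<open>v\<close>.\<close>
  moreover have "(d \<bullet> u) *\<^sub>R e = (e \<bullet> u) *\<^sub>R d + cross2 d e *\<^sub>R vector [- (u$2), u$1]"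
    by (simp add: vec2_eq_iff inner_vec2 cross2_def algebra_simps)
  ultimately have "d \<bullet> u = 0" "d \<bullet> v = 0" using nz by simp_all
  then have "d = 0" using cross2_bisector_dir[OF nc1] unfolding u_def v_def by (intro orthogonal_both_imp_zero)
  then show False using nz by simp
qed

text \<open>The midpoint of the incenter and an excenter lies on the circumcircle.\<close>

lemma dist_bevan_excenter:
  assumes nc: "\<not> collinear {A, B, C}"
  defines "X \<equiv> circumcenter A B C"
  shows "dist (2 *\<^sub>R X - incenter A B C) (excenter A B C) = 2 * dist X A"
proof -
  define a b c where "a = norm (C - B)" and "b = norm (C - A)" and "c = norm (B - A)"
  have ne: "B \<noteq> A" "C \<noteq> A" "C \<noteq> B" using nc by (auto simp: insert_commute)
  then have pos: "a > 0" "b > 0" "c > 0" by (simp_all add: a_def b_def c_def)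
  define s t where "s = a + b + c" and "t = b + c - a"
  have st: "s > 0" "t > 0"
    using pos norm_triangle_strict[OF nc] by (simp_all add: s_def t_def flip: a_def b_def c_def)
  define w where "w = bisector_dir A B C"
  define n where "n = (b * c / s + b * c / t) *\<^sub>R w"
  \<comment> \<open>Here \<open>n\<close> is the sum of the vectors from \<open>A\<close> to the two
    centers; the goal becomes \<open>n \<bullet> n = 4 * (n \<bullet> (X - A))\<close>.\<close>
  have n: "incenter A B C + excenter A B C - 2 *\<^sub>R X = n - 2 *\<^sub>R (X - A)"
    using incenter_bisector(1)[OF nc] excenter_bisector(1)[OF nc]
    by (simp add: n_def w_def s_def t_def a_def b_def c_def algebra_simps scaleR_2)
  \<comment> \<open>Law of cosines: the left side is
    \<open>2 * b * c * (1 + cos A) = (b + c)^2 - a^2\<close>.\<close>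
  have ww: "(b * c) * (w \<bullet> w) = s * t"
  proof -
    have "(B - A) \<bullet> (C - A) * 2 = b\<^sup>2 + c\<^sup>2 - a\<^sup>2"
      unfolding a_def b_def c_def power2_norm_eq_inner by (simp add: inner_diff inner_commute algebra_simps)
    moreover have "w \<bullet> w = 2 + 2 * ((B - A) \<bullet> (C - A)) / (b * c)"
    proof -
      have "sgn u \<bullet> sgn u = 1" if "u \<noteq> 0" for u :: "real^2"
        using that by (simp add: norm_sgn flip: power2_norm_eq_inner)
      then have "w \<bullet> w = 2 + 2 * (sgn (B - A) \<bullet> sgn (C - A))"
        using ne by (simp add: w_def bisector_dir_def inner_add inner_commute)
      then show ?thesis by (simp add: sgn_div_norm b_def c_def divide_inverse)
    qed
    ultimately show ?thesis using pos by (simp add: s_def t_def power2_eq_square field_simps)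
  qed
  have wX: "2 * (w \<bullet> (X - A)) = b + c"
  proof -
    \<comment> \<open>The circumcenter projects to the midpoint of each side through
      \<open>A\<close>.\<close>
    have half: "2 * ((X - A) \<bullet> sgn (V - A)) = norm (V - A)" if "dist X A = dist X V" for V
      using that unfolding dist_eq_iff_inner power2_norm_eq_inner[symmetric]
      by (simp add: sgn_div_norm power2_eq_square) (simp add: field_simps)
    show ?thesis using half[of B] half[of C] dist_circumcenter[OF nc, folded X_def]
      by (simp add: w_def bisector_dir_def inner_add inner_commute b_def c_def)
  qed
  define m where "m = b * c / s + b * c / t"
  have m: "m * (s * t) = 2 * (b * c) * (b + c)" using st by (simp add: m_def field_simps) (simp add: s_def t_def algebra_simps)
  have "(b * c) * (n \<bullet> n) = m * (m * (s * t))"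
    using ww by (simp add: n_def m_def[symmetric] algebra_simps)
  also have "\<dots> = (b * c) * (4 * (n \<bullet> (X - A)))"
    unfolding m using wX by (simp add: n_def m_def[symmetric])
  finally have "n \<bullet> n = 4 * (n \<bullet> (X - A))" using pos by simp
  then have "(norm (n - 2 *\<^sub>R (X - A)))\<^sup>2 = (2 * norm (X - A))\<^sup>2"
    unfolding power_mult_distrib power2_norm_eq_inner by (simp add: inner_diff inner_commute)
  then have "norm (n - 2 *\<^sub>R (X - A)) = 2 * norm (X - A)" by (rule power2_eq_imp_eq) simp_all
  then show ?thesis unfolding n[symmetric] by (simp add: dist_norm norm_minus_commute algebra_simps)
qed

text \<open>The reflected incenter is at distance twice the circumradius from all three
  excenters.\<close>

lemma bevan_point_eq:
  assumes nc: "\<not> collinear {A, B, C}"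
  shows "bevan_point A B C = 2 *\<^sub>R circumcenter A B C - incenter A B C"
proof -
  define X where "X = circumcenter A B C"
  note nc1 = not_collinear_rotate[OF nc]
  note nc2 = not_collinear_rotate[OF nc1]
  note d = dist_circumcenter[OF nc, folded X_def]
  have X: "circumcenter B C A = X" "circumcenter C A B = X"
    using d by (simp_all add: circumcenter_eqI[OF nc1] circumcenter_eqI[OF nc2])
  note dists = dist_bevan_excenter[OF nc, folded X_def]
    dist_bevan_excenter[OF nc1, unfolded X incenter_bisector(2)[OF nc]]
    dist_bevan_excenter[OF nc2, unfolded X incenter_bisector(2)[OF nc1] incenter_bisector(2)[OF nc]]
  show ?thesis unfolding bevan_point_def X_def[symmetric]
    by (rule circumcenter_eqI[OF not_collinear_excenters[OF nc]]) (simp_all add: dists d)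
qed

section \<open>Identification of the cubic and passage to the medial triangle\<close>

text \<open>Uniqueness is built into the locus clause of \<open>is_darboux_cubic\<close>; the
  content is existence, that the locus is a cubic through the nine points.\<close>

lemma darboux_cubic_eq_locus:
  assumes nc: "\<not> collinear {A, B, C}"
  shows "darboux_cubic A B C = darboux_locus A B C"
proof -
  note nc1 = not_collinear_rotate[OF nc]
  note nc2 = not_collinear_rotate[OF nc1]
  note rot = darboux_locus_rotate[OF nc1] darboux_locus_rotate[OF nc]
  have "hpt (excenter A B C) \<in> darboux_locus A B C" if "\<not> collinear {A, B, C}" for A B C
    by (rule self_isogonal_in_darboux_locus[OF excenter_self_isogonal[OF that]])
  note exc = this[OF nc] this[OF nc1] this[OF nc2]
  have inc: "hpt (incenter A B C) \<in> darboux_locus A B C"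
    by (rule self_isogonal_in_darboux_locus[OF incenter_self_isogonal[OF nc]])
  have "hpt ` {A, B, C, excenter A B C, excenter B C A, excenter C A B,
      incenter A B C, circumcenter A B C, bevan_point A B C} \<subseteq> darboux_locus A B C"
    using vertex_in_darboux_locus[OF nc] vertex_in_darboux_locus[OF nc1] vertex_in_darboux_locus[OF nc2]
      exc inc circumcenter_in_darboux_locus(1)[OF nc] darboux_locus_reflect[OF nc inc]
    unfolding bevan_point_eq[OF nc] rot by simp
  then have "is_darboux_cubic A B C K \<longleftrightarrow> K = darboux_locus A B C" for K
    using cubic_curve_darboux_locus[OF nc] unfolding is_darboux_cubic_def darboux_locus_def[symmetric] by blast
  then show ?thesis unfolding darboux_cubic_def by (intro the_equality) simp_all
qed

lemma medial_triangle:
  assumes nc: "\<not> collinear {A, B, C}"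
  defines "M1 \<equiv> midpoint B C" and "M2 \<equiv> midpoint C A" and "M3 \<equiv> midpoint A B"
  shows "\<not> collinear {M1, M2, M3}"
    and "orthocenter M1 M2 M3 = circumcenter A B C"
    and "de_longchamps_point M1 M2 M3 = orthocenter A B C"
proof -
  have "cross2 (M2 - M1) (M3 - M1) = cross2 (B - A) (C - A) / 4"
    by (simp add: M1_def M2_def M3_def midpoint_def cross2_def field_simps)
  then show ncM: "\<not> collinear {M1, M2, M3}" using nc by (simp add: collinear_iff_cross2)
  define X where "X = circumcenter A B C"
  \<comment> \<open>The nine-point center, midpoint of circumcenter and orthocenter; its vectors
    from the side midpoints are half of those from \<open>X\<close> to the vertices.\<close>
  define N where "N = (1/2) *\<^sub>R (A + B + C - X)"
  have "N - M1 = (1/2) *\<^sub>R (A - X)" "N - M2 = (1/2) *\<^sub>R (B - X)" "N - M3 = (1/2) *\<^sub>R (C - X)"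
    by (simp_all add: N_def M1_def M2_def M3_def midpoint_def algebra_simps)
  then have N: "circumcenter M1 M2 M3 = N"
    using dist_circumcenter[OF nc, folded X_def]
    by (intro circumcenter_eqI[OF ncM]) (simp_all add: dist_norm norm_minus_commute)
  show "orthocenter M1 M2 M3 = circumcenter A B C"
    unfolding orthocenter_eq_circumcenter[OF ncM] N X_def[symmetric]
    by (simp add: N_def M1_def M2_def M3_def midpoint_def vec2_eq_iff field_simps)
  then show "de_longchamps_point M1 M2 M3 = orthocenter A B C"
    unfolding de_longchamps_point_def N orthocenter_eq_circumcenter[OF nc] X_def[symmetric]
    by (simp add: N_def scaleR_2 algebra_simps)
qed

theorem theorem5:
  fixes A B C M1 M2 M3 :: "real^2" and K :: "hpoint set"
  assumes "\<not> collinear {A, B, C}"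
    and "M1 = midpoint B C" and "M2 = midpoint C A" and "M3 = midpoint A B"
    and "K = darboux_cubic M1 M2 M3"
  shows "hpt (spieker_point A B C) \<in> K \<and>
    hpt (euler_circle_center A B C) \<in> K \<and>
    hpt (circumcenter A B C) \<in> K \<and>
    hpt (orthocenter A B C) \<in> K \<and>
    complementary_conjugate A B C (hpt (orthocenter A B C)) \<in> K \<and>
    hpt M1 \<in> K \<and> hpt M2 \<in> K \<and> hpt M3 \<in> K \<and>
    hpt (antipode M1 M2 M3) \<in> K \<and>
    hpt (antipode M2 M3 M1) \<in> K \<and>
    hpt (antipode M3 M1 M2) \<in> K"
proof -
  note M = medial_triangle[OF assms(1), folded assms(2-4)]
  note nc = M(1)
  note nc1 = not_collinear_rotate[OF nc]
  note nc2 = not_collinear_rotate[OF nc1]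
  have K: "K = darboux_locus M1 M2 M3" using assms(5) darboux_cubic_eq_locus[OF nc] by simp
  have rot: "darboux_locus M2 M3 M1 = K" "darboux_locus M3 M1 M2 = K"
    using K darboux_locus_rotate[OF nc] darboux_locus_rotate[OF nc1] by simp_all
  have anti: "hpt (antipode P Q R) \<in> darboux_locus P Q R" if "\<not> collinear {P, Q, R}" for P Q R
    unfolding antipode_def by (rule darboux_locus_reflect[OF that vertex_in_darboux_locus[OF that]])
  show ?thesis
    unfolding spieker_point_def euler_circle_center_def complementary_conjugate_def
      assms(2-4)[symmetric]
    \<comment> \<open>After \<open>unfolded M\<close>, the second fact yields the nine-point center
      and the circumcenter of \<open>ABC\<close>, the third the orthocenter and its complementary
      conjugate.\<close>
    using self_isogonal_in_darboux_locus[OF incenter_self_isogonal[OF nc], folded K]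
      circumcenter_in_darboux_locus[OF nc, folded K, unfolded M]
      de_longchamps_point_in_darboux_locus[OF nc, folded K, unfolded M]
      vertex_in_darboux_locus[OF nc, folded K] vertex_in_darboux_locus[OF nc1, unfolded rot]
      vertex_in_darboux_locus[OF nc2, unfolded rot]
      anti[OF nc, folded K] anti[OF nc1, unfolded rot] anti[OF nc2, unfolded rot]
    by blast
qed

end
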